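(* Let $A$ and $B$ be commuting posinormal operators with closed range on a complex Hilbert space $\mathcal{H}$, and write, with respect to the decomposition $\mathcal{H}=\mathcal{N}(A)^\perp\oplus\mathcal{N}(A)$, $$A=\begin{pmatrix}A'&O\\ O&O\end{pmatrix},\qquad B=\begin{pmatrix}B'&O\\ Y&Z\end{pmatrix}.$$ If $B'$ is posinormal and $Z$ is coposinormal, then $AB$ is posinormal with closed range.
   Context: An operator is a bounded linear transformation of a Hilbert space into itself. $\mathcal{N}(T)$ and $\mathcal{R}(T)$ denote the kernel and range of $T$. An operator $T$ is posinormal if $\mathcal{R}(T)\subseteq\mathcal{R}(T^* )$, and coposinormal if $T^*$ is posinormal. If $A$ is posinormal then $\mathcal{N}(A)$ reduces $A$, and if moreover $B$ commutes with $A$, then $A$ and $B$ do have matrix representations of the displayed form, with $A',B'$ operators on $\mathcal{N}(A)^\perp$, $Z=B|_{\mathcal{N}(A)}$ an operator on $\mathcal{N}(A)$, $Y:\mathcal{N}(A)^\perp\to\mathcal{N}(A)$ bounded linear, and $YA'=O$. *)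

theory Defs
  imports "HOL-Analysis.Analysis"
begin

section \<open>Complex Hilbert spaces\<close>

text \<open>
  The underlying real Hilbert space, with inner product the real part of the complex one, is
  inherited from \<open>real_inner\<close>, so that the norm, the topology and completeness are those of the
  library.  The complex inner product is linear in the first and conjugate linear in the second
  argument; \<open>inner_eq_Re_cinner\<close> makes it positive definite and makes it induce the norm.
\<close>

class complex_hilbert_space = real_inner + complete_space +
  fixes scaleC :: "complex \<Rightarrow> 'a \<Rightarrow> 'a"  (infixr \<open>*\<^sub>C\<close> 75)
    and cinner :: "'a \<Rightarrow> 'a \<Rightarrow> complex"
  assumes scaleR_scaleC: "r *\<^sub>R x = complex_of_real r *\<^sub>C x"
    and scaleC_add_right: "c *\<^sub>C (x + y) = c *\<^sub>C x + c *\<^sub>C y"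
    and scaleC_add_left: "(c + d) *\<^sub>C x = c *\<^sub>C x + d *\<^sub>C x"
    and scaleC_scaleC: "c *\<^sub>C (d *\<^sub>C x) = (c * d) *\<^sub>C x"
    and cinner_commute: "cinner x y = cnj (cinner y x)"
    and cinner_add_left: "cinner (x + y) z = cinner x z + cinner y z"
    and cinner_scaleC_left: "cinner (c *\<^sub>C x) y = c * cinner x y"
    and inner_eq_Re_cinner: "inner x y = Re (cinner x y)"

instantiation complex :: complex_hilbert_space
begin

definition scaleC_complex :: "complex \<Rightarrow> complex \<Rightarrow> complex" where
  "scaleC_complex c x = c * x"

definition cinner_complex :: "complex \<Rightarrow> complex \<Rightarrow> complex" where
  "cinner_complex x y = x * cnj y"

instance
  by standard
    (auto simp: scaleC_complex_def cinner_complex_def inner_complex_def scaleR_conv_of_real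
      algebra_simps)

end

lemma cinner_self: "cinner x x = complex_of_real ((norm x)\<^sup>2)"
proof (rule complex_eqI)
  show "Re (cinner x x) = Re (complex_of_real ((norm x)\<^sup>2))"
    by (simp add: inner_eq_Re_cinner[symmetric] power2_norm_eq_inner)
  have "Im (cinner x x) = - Im (cinner x x)"
    by (subst cinner_commute) simp
  then show "Im (cinner x x) = Im (complex_of_real ((norm x)\<^sup>2))"
    by simp
qed

definition orthocomplement :: "'a::complex_hilbert_space set \<Rightarrow> 'a set" where
  "orthocomplement S = {x. \<forall>y\<in>S. cinner x y = 0}"

definition null_space :: "('a::complex_hilbert_space \<Rightarrow> 'a) \<Rightarrow> 'a set" where
  "null_space T = {x. T x = 0}"


section \<open>Operators on closed subspaces\<close>

text \<open>
  Operators on a closed subspace \<open>M\<close> (a Hilbert space in its own right) are functions on the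
  ambient type of which only the values on \<open>M\<close> matter; \<open>M = UNIV\<close> gives operators on the whole
  space.
\<close>

definition bounded_clinear_on ::
  "'a::complex_hilbert_space set \<Rightarrow> 'a set \<Rightarrow> ('a \<Rightarrow> 'a) \<Rightarrow> bool" where
  "bounded_clinear_on M N T \<longleftrightarrow>
     (\<forall>x\<in>M. T x \<in> N) \<and>
     (\<forall>x\<in>M. \<forall>y\<in>M. T (x + y) = T x + T y) \<and>
     (\<forall>c. \<forall>x\<in>M. T (c *\<^sub>C x) = c *\<^sub>C T x) \<and>
     (\<exists>K. \<forall>x\<in>M. norm (T x) \<le> K * norm x)"

abbreviation operator_on :: "'a::complex_hilbert_space set \<Rightarrow> ('a \<Rightarrow> 'a) \<Rightarrow> bool" where
  "operator_on M T \<equiv> bounded_clinear_on M M T"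

text \<open>
  The adjoint is taken within the Hilbert space \<open>M\<close>.  For \<open>y \<in> M\<close> the described vector exists and
  is unique, by the Riesz representation theorem, when \<open>M\<close> is a closed subspace and \<open>T\<close> an
  operator on \<open>M\<close>.
\<close>

definition adjoint_on ::
  "'a::complex_hilbert_space set \<Rightarrow> ('a \<Rightarrow> 'a) \<Rightarrow> 'a \<Rightarrow> 'a" where
  "adjoint_on M T y = (THE z. z \<in> M \<and> (\<forall>x\<in>M. cinner (T x) y = cinner x z))"

definition posinormal_on :: "'a::complex_hilbert_space set \<Rightarrow> ('a \<Rightarrow> 'a) \<Rightarrow> bool" where
  "posinormal_on M T \<longleftrightarrow> operator_on M T \<and> T ` M \<subseteq> adjoint_on M T ` M"

definition coposinormal_on :: "'a::complex_hilbert_space set \<Rightarrow> ('a \<Rightarrow> 'a) \<Rightarrow> bool" where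
  "coposinormal_on M T \<longleftrightarrow> operator_on M T \<and> posinormal_on M (adjoint_on M T)"

abbreviation posinormal :: "('a::complex_hilbert_space \<Rightarrow> 'a) \<Rightarrow> bool" where
  "posinormal T \<equiv> posinormal_on UNIV T"

text \<open>
  \<open>T\<close> has, with respect to \<open>M \<oplus> N\<close>, the block matrix with first row \<open>P\<close>, \<open>Q\<close> and second row
  \<open>R\<close>, \<open>S\<close>.  It is used only when the whole space is the orthogonal sum of \<open>M\<close> and \<open>N\<close>.
\<close>

definition has_block_matrix ::
  "('a::complex_hilbert_space \<Rightarrow> 'a) \<Rightarrow> 'a set \<Rightarrow> 'a set \<Rightarrow>
   ('a \<Rightarrow> 'a) \<Rightarrow> ('a \<Rightarrow> 'a) \<Rightarrow> ('a \<Rightarrow> 'a) \<Rightarrow> ('a \<Rightarrow> 'a) \<Rightarrow> bool" where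
  "has_block_matrix T M N P Q R S \<longleftrightarrow>
     bounded_clinear_on M M P \<and> bounded_clinear_on N M Q \<and>
     bounded_clinear_on M N R \<and> bounded_clinear_on N N S \<and>
     (\<forall>x\<in>M. \<forall>y\<in>N. T (x + y) = (P x + Q y) + (R x + S y))"

end

theory Submission imports Defs begin

text \<open>
  Put \<open>N = \<N>(A)\<close> and \<open>M = N\<^sup>\<bottom>\<close>.  Everything rests on two observations.

  First, \<open>AB\<close> vanishes on \<open>N\<close> and equals \<open>A'B' = B'A'\<close> on \<open>M\<close>; commutation kills the
  corner \<open>Y\<close> on the range of \<open>A\<close>.  Since \<open>A\<close> has closed range, \<open>A\<^sup>*\<close> maps onto \<open>M\<close>, so
  \<open>(AB)\<^sup>* = B\<^sup>*A\<^sup>*\<close> has the range of \<open>B'\<^sup>*\<close>.  Hence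
  \<open>\<R>(AB) = \<R>(B'A') \<subseteq> \<R>(B') \<subseteq> \<R>(B'\<^sup>*) = \<R>((AB)\<^sup>*)\<close>, which is posinormality.

  Secondly, \<open>\<R>(AB) = A(\<R>(B'))\<close> and \<open>A\<close> is bounded below on \<open>M\<close>, so the range of \<open>AB\<close>
  is closed once that of \<open>B'\<close> is.  Posinormality of \<open>B\<close>, read off in the \<open>N\<close>-component, puts
  \<open>\<R>(Y)\<close> into \<open>\<R>(Z\<^sup>*)\<close>, and coposinormality of \<open>Z\<close> puts that into \<open>\<R>(Z)\<close>.  The entry
  \<open>Y\<close> can therefore be cancelled by a column operation: every \<open>B'x\<close> is itself a value of \<open>B\<close>,
  and \<open>\<R>(B') = \<R>(B) \<inter> M\<close> is closed (\<open>closed_range_corner\<close>).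

  The analytic input is the closed range theorem, in the form that \<open>T\<^sup>*\<close> maps onto
  \<open>\<N>(T)\<^sup>\<bottom>\<close> with norm control (\<open>closed_range_adjoint_solvable\<close>); it is derived from the
  uniform boundedness principle.  The Hilbert space arguments use only the real inner product:
  on a complex subspace the real and the complex notions of orthogonality and of adjoint agree,
  and \<open>posinormal_on_iff_inner\<close> translates posinormality accordingly.
\<close>

section \<open>Closed subspaces of real Hilbert spaces\<close>

text \<open>
  By the parallelogram law, points of \<open>C\<close> whose norms are nearly the infimum \<open>d\<close> lie close
  together, because their midpoint again has norm at least \<open>d\<close>.  A minimizing sequence is
  therefore Cauchy.
\<close>

lemma closed_convex_has_minimal_norm:
  fixes C :: "'a::{real_inner,complete_space} set"
  assumes "closed C" "convex C" "C \<noteq> {}"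
  shows "\<exists>w\<in>C. \<forall>y\<in>C. norm w \<le> norm y"
proof -
  define d where "d = Inf (norm ` C)"
  have bdd: "bdd_below (norm ` C)"
    by (rule bdd_belowI[of _ 0]) auto
  have d_le: "d \<le> norm y" if "y \<in> C" for y
    unfolding d_def using that bdd by (simp add: cINF_lower)
  have d0: "0 \<le> d"
    unfolding d_def using assms(3) by (auto intro: cINF_greatest)
  have "\<exists>x\<in>C. norm x < d + 1 / real (Suc n)" for n
  proof -
    have "Inf (norm ` C) < d + 1 / real (Suc n)"
      unfolding d_def by simp
    then show ?thesis
      using cINF_less_iff[OF assms(3) bdd] by blast
  qed
  then obtain x where xC: "x n \<in> C" and x_less: "norm (x n) < d + 1 / real (Suc n)" for n
    by metis
  have close: "(norm (x m - x n))\<^sup>2 \<le> 4 * (2 * d + 1) / real (Suc N)"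
    if "m \<ge> N" "n \<ge> N" for m n N
  proof -
    have mid: "(1/2) *\<^sub>R x m + (1/2) *\<^sub>R x n \<in> C"
      using assms(2) xC by (simp add: convexD)
    have par: "(norm (x m - x n))\<^sup>2 =
        2 * (norm (x m))\<^sup>2 + 2 * (norm (x n))\<^sup>2 - 4 * (norm ((1/2) *\<^sub>R x m + (1/2) *\<^sub>R x n))\<^sup>2"
      by (simp add: power2_norm_eq_inner inner_add_left inner_add_right inner_diff_left
          inner_diff_right inner_commute algebra_simps)
    have sq: "(norm (x k))\<^sup>2 \<le> d\<^sup>2 + (2 * d + 1) / real (Suc N)" if "k \<ge> N" for k
    proof -
      define e where "e = 1 / real (Suc N)"
      have e: "0 \<le> e" "e \<le> 1" by (auto simp: e_def)
      have "1 / real (Suc k) \<le> e"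
        unfolding e_def using that by (simp add: frac_le)
      then have "norm (x k) \<le> d + e"
        using x_less[of k] by linarith
      then have "(norm (x k))\<^sup>2 \<le> (d + e)\<^sup>2"
        by (simp add: power_mono)
      also have "\<dots> = d\<^sup>2 + 2 * d * e + e * e"
        by (simp add: power2_eq_square algebra_simps)
      also have "\<dots> \<le> d\<^sup>2 + 2 * d * e + e"
        using mult_left_mono[OF e(2) e(1)] by simp
      finally show ?thesis
        by (simp add: e_def add_divide_distrib)
    qed
    have "d\<^sup>2 \<le> (norm ((1/2) *\<^sub>R x m + (1/2) *\<^sub>R x n))\<^sup>2"
      using d_le[OF mid] d0 by (simp add: power_mono)
    then have "(norm (x m - x n))\<^sup>2 \<le> 4 * ((2 * d + 1) / real (Suc N))"
      using par sq[OF that(1)] sq[OF that(2)] by linarith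
    then show ?thesis by simp
  qed
  have "Cauchy x"
  proof (rule CauchyI)
    fix e :: real assume e: "0 < e"
    obtain N where N: "4 * (2 * d + 1) / e\<^sup>2 < real N"
      using reals_Archimedean2 by blast
    have "norm (x m - x n) < e" if "m \<ge> N" "n \<ge> N" for m n
    proof -
      have "4 * (2 * d + 1) / e\<^sup>2 < real (Suc N)"
        using N by simp
      then have "4 * (2 * d + 1) / real (Suc N) < e\<^sup>2"
        using e by (simp add: field_simps)
      then have "(norm (x m - x n))\<^sup>2 < e\<^sup>2"
        using close[OF that] by linarith
      then show ?thesis
        using e by (simp add: power_less_imp_less_base)
    qed
    then show "\<exists>M. \<forall>m\<ge>M. \<forall>n\<ge>M. norm (x m - x n) < e" by blast
  qed
  then obtain w where w: "x \<longlonglongrightarrow> w"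
    using Cauchy_convergent convergent_def by blast
  have wC: "w \<in> C"
    using assms(1) xC w closed_sequentially by blast
  have "(\<lambda>n. d + 1 / real (Suc n)) \<longlonglongrightarrow> d + 0"
    by (intro tendsto_intros LIMSEQ_Suc lim_1_over_n)
  then have "norm w \<le> d + 0"
    using tendsto_norm[OF w] x_less by (intro LIMSEQ_le) (auto intro: less_imp_le)
  then have "norm w \<le> norm y" if "y \<in> C" for y
    using d_le[OF that] by linarith
  then show ?thesis
    using wC by blast
qed

text \<open>
  The residual \<open>w = x - p\<close> at a nearest point \<open>p\<close> is orthogonal to \<open>S\<close>: otherwise subtracting
  from \<open>w\<close> its component along some \<open>y \<in> S\<close> would shorten it.
\<close>

lemma orthogonal_projection_exists:
  fixes S :: "'a::{real_inner,complete_space} set"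
  assumes "subspace S" "closed S"
  shows "\<exists>p\<in>S. \<forall>y\<in>S. inner (x - p) y = 0"
proof -
  have "closed ((\<lambda>s. x - s) ` S)"
    using assms(2) closed_translation[of "uminus ` S" x] closed_negations[of S]
    by (simp add: image_image)
  moreover have "convex ((\<lambda>s. x - s) ` S)"
    using convex_translation[OF convex_negations[OF subspace_imp_convex[OF assms(1)]], of x]
    by (simp add: image_image)
  moreover have "(\<lambda>s. x - s) ` S \<noteq> {}"
    using subspace_0[OF assms(1)] by blast
  ultimately obtain p where p: "p \<in> S" and min: "\<And>y. y \<in> S \<Longrightarrow> norm (x - p) \<le> norm (x - y)"
    using closed_convex_has_minimal_norm[of "(\<lambda>s. x - s) ` S"] by auto
  have "inner (x - p) y = 0" if y: "y \<in> S" for y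
  proof (cases "y = 0")
    case False
    define w t where "w = x - p" and "t = inner w y / inner y y"
    have yy: "inner y y > 0" using False by simp
    have "p + t *\<^sub>R y \<in> S"
      using assms(1) p y by (simp add: subspace_add subspace_scale)
    then have "norm w \<le> norm (w - t *\<^sub>R y)"
      using min[of "p + t *\<^sub>R y"] by (simp add: w_def diff_diff_eq)
    then have "inner w w \<le> inner (w - t *\<^sub>R y) (w - t *\<^sub>R y)"
      by (simp add: norm_le)
    also have "\<dots> = inner w w - 2 * t * inner w y + t * (t * inner y y)"
      by (simp add: inner_diff_left inner_diff_right inner_commute algebra_simps)
    also have "t * inner y y = inner w y"
      using yy by (simp add: t_def)
    finally have "t * inner w y \<le> 0" by simp
    then have "(inner w y)\<^sup>2 \<le> 0"
      using yy by (simp add: t_def power2_eq_square divide_le_0_iff)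
    then show ?thesis by (simp add: w_def)
  qed simp
  then show ?thesis using p by blast
qed

text \<open>
  The kernel of \<open>f\<close> has codimension at most one in \<open>S\<close>, so \<open>f\<close> is a multiple of the inner
  product with a vector \<open>w\<close> orthogonal to that kernel.  The functional is only required to be linear
  on \<open>S\<close>, so that the lemma applies to operators that are specified on a subspace alone.
\<close>

lemma riesz_representation_on:
  fixes S :: "'a::{real_inner,complete_space} set" and f :: "'a \<Rightarrow> real"
  assumes S: "subspace S" "closed S"
    and add: "\<And>x y. x \<in> S \<Longrightarrow> y \<in> S \<Longrightarrow> f (x + y) = f x + f y"
    and scale: "\<And>c x. x \<in> S \<Longrightarrow> f (c *\<^sub>R x) = c * f x"
    and bound: "\<And>x. x \<in> S \<Longrightarrow> \<bar>f x\<bar> \<le> K * norm x"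
  shows "\<exists>z\<in>S. \<forall>x\<in>S. f x = inner x z"
proof (cases "\<forall>x\<in>S. f x = 0")
  case True
  then show ?thesis using subspace_0[OF S(1)] by (intro bexI[of _ 0]) auto
next
  case False
  then obtain x0 where x0: "x0 \<in> S" "f x0 \<noteq> 0" by blast
  have diff: "f (x - y) = f x - f y" if "x \<in> S" "y \<in> S" for x y
    using add[of x "(-1) *\<^sub>R y"] scale[of y "-1"] that S(1) by (simp add: subspace_neg)
  have lip: "\<bar>f x - f y\<bar> \<le> \<bar>K\<bar> * norm (x - y)" if "x \<in> S" "y \<in> S" for x y
  proof -
    have "\<bar>f (x - y)\<bar> \<le> K * norm (x - y)"
      using bound that S(1) by (simp add: subspace_diff)
    also have "\<dots> \<le> \<bar>K\<bar> * norm (x - y)"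
      by (intro mult_right_mono) auto
    finally show ?thesis using diff that by simp
  qed
  have "\<bar>K\<bar>-lipschitz_on S f"
    by (rule lipschitz_onI) (auto simp: dist_norm lip)
  then have "continuous_on S f"
    by (rule lipschitz_on_continuous_on)
  then have "closed {x \<in> S. f x = 0}"
    using S(2) by (rule continuous_closed_preimage_constant)
  moreover have "subspace {x \<in> S. f x = 0}"
    using S(1) add scale scale[of 0 0]
    by (auto simp: subspace_def)
  ultimately obtain p where p: "p \<in> S" "f p = 0"
    and orth: "\<And>y. y \<in> S \<Longrightarrow> f y = 0 \<Longrightarrow> inner (x0 - p) y = 0"
    using orthogonal_projection_exists[of "{x \<in> S. f x = 0}" x0] by auto
  define w where "w = x0 - p"
  have w: "w \<in> S" "f w \<noteq> 0"
    using S(1) x0 p by (auto simp: w_def subspace_diff diff)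
  then have w0: "inner w w \<noteq> 0"
    using scale[of 0 0] subspace_0[OF S(1)] by auto
  have "f x = inner x ((f w / inner w w) *\<^sub>R w)" if x: "x \<in> S" for x
  proof -
    have "f (x - (f x / f w) *\<^sub>R w) = 0"
      using x w S(1) by (simp add: diff scale subspace_scale)
    then have "inner w (x - (f x / f w) *\<^sub>R w) = 0"
      using orth x w S(1) by (simp add: w_def[symmetric] subspace_diff subspace_scale)
    then have "inner x w = f x / f w * inner w w"
      by (simp add: inner_diff_right inner_commute)
    then show ?thesis using w(2) w0 by simp
  qed
  moreover have "(f w / inner w w) *\<^sub>R w \<in> S"
    using w(1) S(1) by (simp add: subspace_scale)
  ultimately show ?thesis by blast
qed

section \<open>Operators with closed range\<close>

text \<open>
  The uniform boundedness principle for the functionals given by the inner product with the elements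
  of \<open>S\<close>: by Baire's theorem they are uniformly bounded on some ball, hence on a ball about the
  origin.
\<close>

lemma weakly_bounded_imp_bounded:
  fixes S :: "'a::{real_inner,complete_space} set"
  assumes "\<And>x. \<exists>c. \<forall>z\<in>S. \<bar>inner x z\<bar> \<le> c"
  shows "\<exists>K. \<forall>z\<in>S. norm z \<le> K"
proof -
  define F where "F n = {x. \<forall>z\<in>S. \<bar>inner x z\<bar> \<le> real n}" for n
  have F_closed: "closed (F n)" for n
  proof -
    have "F n = (\<Inter>z\<in>S. {x. \<bar>inner x z\<bar> \<le> real n})"
      by (auto simp: F_def)
    then show ?thesis
      by (auto intro!: closed_INT closed_Collect_le continuous_intros)
  qed
  have cover: "\<Union>(range F) = UNIV"
  proof -
    have "\<exists>n. x \<in> F n" for x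
    proof -
      obtain c where c: "\<forall>z\<in>S. \<bar>inner x z\<bar> \<le> c" using assms by blast
      obtain n where n: "c \<le> real n" using real_arch_simple by blast
      have "x \<in> F n"
        unfolding F_def using c n by (auto intro: order_trans)
      then show ?thesis by blast
    qed
    then show ?thesis by blast
  qed
  have "\<exists>n. interior (F n) \<noteq> {}"
  proof (rule ccontr)
    assume "\<nexists>n. interior (F n) \<noteq> {}"
    then have "euclidean interior_of \<Union>(range F) = {}"
      using F_closed
      by (intro Baire_category_alt)
        (auto simp: completely_metrizable_space_euclidean)
    then show False using cover by simp
  qed
  then obtain n x0 e where e: "e > 0" "cball x0 e \<subseteq> F n"
    by (auto simp: mem_interior_cball)
  have "norm z \<le> 2 * real n / e" if z: "z \<in> S" for z
  proof (cases "z = 0")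
    case False
    \<comment> \<open>the point of the ball at which the inner product with \<open>z\<close> is largest\<close>
    define y where "y = x0 + (e / norm z) *\<^sub>R z"
    have "y \<in> cball x0 e" "x0 \<in> cball x0 e"
      using e(1) False by (auto simp: y_def dist_norm)
    then have "\<bar>inner y z\<bar> \<le> real n" "\<bar>inner x0 z\<bar> \<le> real n"
      using subsetD[OF e(2)] z unfolding F_def by blast+
    moreover have "inner y z = inner x0 z + e * norm z"
      using False by (simp add: y_def inner_add_left power2_norm_eq_inner[symmetric] power2_eq_square)
    ultimately have "e * norm z \<le> 2 * real n" by linarith
    then show ?thesis using e(1) by (simp add: field_simps)
  qed (use e in auto)
  then show ?thesis by blast
qed

lemma real_adjoint_exists:
  fixes T :: "'a::{real_inner,complete_space} \<Rightarrow> 'a"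
  assumes "bounded_linear T"
  shows "\<exists>T'. bounded_linear T' \<and> (\<forall>x y. inner (T x) y = inner x (T' y))"
proof -
  interpret T: bounded_linear T by fact
  obtain K where K: "\<And>x. norm (T x) \<le> norm x * K" "0 \<le> K" using T.nonneg_bounded by blast
  have "\<exists>z. \<forall>x. inner (T x) y = inner x z" for y
  proof -
    have "\<bar>inner (T x) y\<bar> \<le> (K * norm y) * norm x" for x
    proof -
      have "\<bar>inner (T x) y\<bar> \<le> norm (T x) * norm y" by (rule Cauchy_Schwarz_ineq2)
      also have "\<dots> \<le> (norm x * K) * norm y" by (intro mult_right_mono K) auto
      finally show ?thesis by (simp add: algebra_simps)
    qed
    then show ?thesis
      using riesz_representation_on[of UNIV "\<lambda>x. inner (T x) y"]
      by (auto simp: T.add T.scaleR inner_add_left)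
  qed
  then obtain T' where T': "\<And>x y. inner (T x) y = inner x (T' y)" by metis
  \<comment> \<open>the adjoint inherits additivity and homogeneity because its values are unique\<close>
  have uniq: "u = v" if "\<And>x. inner x u = inner x v" for u v :: 'a
    using that[of "u - v"] inner_diff_right[of "u - v" u v] by simp
  have "norm (T' y) \<le> norm y * K" for y
  proof -
    have "norm (T' y) * norm (T' y) = inner (T (T' y)) y"
      by (simp add: T' power2_norm_eq_inner[symmetric] power2_eq_square)
    also have "\<dots> \<le> norm (T (T' y)) * norm y" by (rule norm_cauchy_schwarz)
    also have "\<dots> \<le> (norm (T' y) * K) * norm y" by (intro mult_right_mono K) auto
    finally have "norm (T' y) * norm (T' y) \<le> norm (T' y) * (norm y * K)"
      by (simp add: algebra_simps)
    then show ?thesis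
      using K(2) by (cases "T' y = 0") auto
  qed
  then have "bounded_linear T'"
    by (intro bounded_linear_intro[of _ K])
      (auto intro!: uniq simp: T'[symmetric] inner_add_right)
  then show ?thesis using T' by blast
qed

text \<open>
  The hard half of the closed range theorem: \<open>T\<^sup>*v = u\<close> is solvable for every \<open>u\<close> orthogonal to
  the kernel of \<open>T\<close>, with \<open>v\<close> controlled by \<open>u\<close>.  Let \<open>R\<close> be the closed range of \<open>T\<close>.
  For \<open>z \<in> R\<close> with \<open>\<parallel>T\<^sup>*z\<parallel> \<le> 1\<close> the inner product of \<open>z\<close> with \<open>Tx\<close> is at most
  \<open>\<parallel>x\<parallel>\<close>, so these \<open>z\<close> are weakly bounded, hence bounded: \<open>T\<^sup>*\<close> is bounded below on \<open>R\<close>.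
  Thus \<open>T\<^sup>*(R)\<close> is closed, and what is orthogonal to it lies in the kernel of \<open>T\<close>.
\<close>

lemma closed_range_adjoint_solvable:
  fixes T :: "'a::{real_inner,complete_space} \<Rightarrow> 'a"
  assumes "bounded_linear T" "closed (range T)"
  shows "\<exists>K\<ge>0. \<forall>u. (\<forall>n. T n = 0 \<longrightarrow> inner n u = 0) \<longrightarrow>
           (\<exists>v. norm v \<le> K * norm u \<and> (\<forall>x. inner (T x) v = inner x u))"
proof -
  interpret T: bounded_linear T by fact
  obtain T' where "bounded_linear T'" and T': "\<And>x y. inner (T x) y = inner x (T' y)"
    using real_adjoint_exists[OF assms(1)] by blast
  interpret T': bounded_linear T' by fact
  define R where "R = range T"
  have R: "subspace R" "closed R"
    using assms(2) by (auto simp: R_def T.linear_axioms linear_subspace_image)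
  have "\<exists>c. \<forall>z\<in>{z \<in> R. norm (T' z) \<le> 1}. \<bar>inner h z\<bar> \<le> c" for h
  proof -
    obtain p where "p \<in> R" and p: "\<And>y. y \<in> R \<Longrightarrow> inner (h - p) y = 0"
      using orthogonal_projection_exists[OF R, of h] by blast
    then obtain x where x: "p = T x" by (auto simp: R_def)
    have "\<bar>inner h z\<bar> \<le> norm x" if "z \<in> R" "norm (T' z) \<le> 1" for z
    proof -
      have "inner h z = inner x (T' z)"
        using p[OF that(1)] by (simp add: x inner_diff_left T')
      also have "\<bar>\<dots>\<bar> \<le> norm x * norm (T' z)" by (rule Cauchy_Schwarz_ineq2)
      also have "\<dots> \<le> norm x * 1" by (intro mult_left_mono that) auto
      finally show ?thesis by simp
    qed
    then show ?thesis by blast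
  qed
  then obtain K0 where K0: "\<And>z. z \<in> R \<Longrightarrow> norm (T' z) \<le> 1 \<Longrightarrow> norm z \<le> K0"
    using weakly_bounded_imp_bounded[of "{z \<in> R. norm (T' z) \<le> 1}"] by blast
  \<comment> \<open>a bound for the weakly bounded set that is positive, to be divided by below\<close>
  define K where "K = max K0 1"
  have K: "K > 0" by (simp add: K_def)
  have inj: "z = 0" if z: "z \<in> R" "T' z = 0" for z
  proof -
    obtain x where "z = T x" using z(1) by (auto simp: R_def)
    then have "inner z z = 0" using z(2) T'[of x z] by simp
    then show ?thesis by simp
  qed
  have below: "norm z \<le> K * norm (T' z)" if z: "z \<in> R" for z
  proof (cases "T' z = 0")
    case False
    have "norm ((1 / norm (T' z)) *\<^sub>R z) \<le> K0"
      using z R(1) False by (intro K0) (auto simp: subspace_scale T'.scaleR)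
    then have "norm z / norm (T' z) \<le> K" by (simp add: K_def)
    then show ?thesis using False by (simp add: field_simps)
  qed (use inj z in auto)
  have "complete (T' ` R)"
  proof (rule complete_isometric_image[of "1 / K"])
    show "\<forall>x\<in>R. 1 / K * norm x \<le> norm (T' x)"
      using below K by (simp add: field_simps)
  qed (use K R T'.bounded_linear_axioms in \<open>auto simp: complete_eq_closed\<close>)
  then have T'R: "closed (T' ` R)" "subspace (T' ` R)"
    using R by (auto simp: complete_eq_closed T'.linear_axioms linear_subspace_image)
  have "\<exists>v. norm v \<le> K * norm u \<and> (\<forall>x. inner (T x) v = inner x u)"
    if u: "\<And>n. T n = 0 \<Longrightarrow> inner n u = 0" for u
  proof -
    obtain v where v: "v \<in> R" and orth: "\<And>z. z \<in> R \<Longrightarrow> inner (u - T' v) (T' z) = 0"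
      using orthogonal_projection_exists[OF T'R(2,1), of u] by blast
    define w where "w = u - T' v"
    \<comment> \<open>\<open>w\<close> is orthogonal to \<open>T\<^sup>*(R)\<close>, in particular to \<open>T\<^sup>*(T w)\<close>\<close>
    have "inner (T w) (T w) = 0"
      using orth[of "T w"] by (simp add: T' w_def R_def)
    then have "T w = 0" by simp
    moreover have "inner w (T' v) = 0"
      using orth[OF v] by (simp add: w_def)
    ultimately have "inner w w = 0"
      using u[of w] by (simp add: w_def inner_diff_right)
    then have "u = T' v" by (simp add: w_def)
    then show ?thesis using below[OF v] T' by auto
  qed
  then show ?thesis using K by (intro exI[of _ K]) auto
qed

text \<open>
  The solution \<open>v\<close> of \<open>T\<^sup>*v = u\<close> gives \<open>\<parallel>u\<parallel>\<^sup>2 = \<langle>Tu, v\<rangle> \<le> K \<parallel>Tu\<parallel> \<parallel>u\<parallel>\<close>.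
\<close>

lemma closed_range_bounded_below:
  fixes T :: "'a::{real_inner,complete_space} \<Rightarrow> 'a"
  assumes "bounded_linear T" "closed (range T)"
  shows "\<exists>e>0. \<forall>u. (\<forall>n. T n = 0 \<longrightarrow> inner n u = 0) \<longrightarrow> e * norm u \<le> norm (T u)"
proof -
  obtain K where K: "K \<ge> 0" and sol: "\<And>u. (\<forall>n. T n = 0 \<longrightarrow> inner n u = 0) \<Longrightarrow>
           \<exists>v. norm v \<le> K * norm u \<and> (\<forall>x. inner (T x) v = inner x u)"
    using closed_range_adjoint_solvable[OF assms] by blast
  have "norm u \<le> (K + 1) * norm (T u)" if u: "\<forall>n. T n = 0 \<longrightarrow> inner n u = 0" for u
  proof -
    obtain v where v: "norm v \<le> K * norm u" "\<And>x. inner (T x) v = inner x u"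
      using sol[OF u] by blast
    have "norm u * norm u = inner (T u) v"
      by (simp add: v power2_norm_eq_inner[symmetric] power2_eq_square)
    also have "\<dots> \<le> norm (T u) * norm v" by (rule norm_cauchy_schwarz)
    also have "\<dots> \<le> norm (T u) * (K * norm u)" by (intro mult_left_mono v) auto
    finally have "norm u * norm u \<le> norm u * (K * norm (T u))" by (simp add: algebra_simps)
    then have "norm u \<le> K * norm (T u)"
      using K by (cases "u = 0") auto
    then show ?thesis by (simp add: distrib_right add_increasing2)
  qed
  then show ?thesis
    using K by (intro exI[of _ "1 / (K + 1)"]) (simp add: field_simps)
qed

section \<open>Complex structure and adjoints\<close>

definition csubspace :: "'a::complex_hilbert_space set \<Rightarrow> bool" where
  "csubspace S \<longleftrightarrow> 0 \<in> S \<and> (\<forall>x\<in>S. \<forall>y\<in>S. x + y \<in> S) \<and> (\<forall>c. \<forall>x\<in>S. c *\<^sub>C x \<in> S)"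

lemma csubspace_UNIV: "csubspace UNIV"
  by (simp add: csubspace_def)

lemma csubspace_scaleC: "csubspace S \<Longrightarrow> x \<in> S \<Longrightarrow> c *\<^sub>C x \<in> S"
  by (simp add: csubspace_def)

lemma csubspace_imp_subspace: "csubspace S \<Longrightarrow> subspace S"
  by (simp add: csubspace_def subspace_def scaleR_scaleC)

lemma Im_cinner: "Im (cinner x y) = - inner (\<i> *\<^sub>C x) y"
  by (simp add: inner_eq_Re_cinner cinner_scaleC_left)

text \<open>
  The imaginary part of the complex inner product with \<open>x\<close> is, up to sign, the real inner product
  with \<open>\<i>x\<close>, and \<open>\<i>x\<close> stays in a complex subspace.  The same remark makes the real and the
  complex adjoint identities equivalent further down.
\<close>

lemma cinner_eq_0_iff_inner:
  assumes "csubspace S"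
  shows "(\<forall>x\<in>S. cinner x y = 0) \<longleftrightarrow> (\<forall>x\<in>S. inner x y = 0)"
proof
  assume "\<forall>x\<in>S. inner x y = 0"
  then show "\<forall>x\<in>S. cinner x y = 0"
    using csubspace_scaleC[OF assms]
    by (auto intro!: complex_eqI simp: Im_cinner inner_eq_Re_cinner[symmetric])
qed (auto simp: inner_eq_Re_cinner)

lemma mem_orthocomplement_iff_inner:
  assumes "csubspace S"
  shows "x \<in> orthocomplement S \<longleftrightarrow> (\<forall>y\<in>S. inner y x = 0)"
proof -
  have "cinner x y = 0 \<longleftrightarrow> cinner y x = 0" for y
    by (subst cinner_commute) simp
  then have "x \<in> orthocomplement S \<longleftrightarrow> (\<forall>y\<in>S. cinner y x = 0)"
    by (simp add: orthocomplement_def)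
  then show ?thesis using cinner_eq_0_iff_inner[OF assms] by simp
qed

lemma csubspace_orthocomplement: "csubspace (orthocomplement S)"
proof -
  have "cinner 0 y = 0" for y :: 'a
    using cinner_add_left[of 0 0 y] by simp
  then show ?thesis
    by (auto simp: csubspace_def orthocomplement_def cinner_add_left cinner_scaleC_left)
qed

lemma closed_orthocomplement:
  assumes "csubspace S"
  shows "closed (orthocomplement S)"
proof -
  have "orthocomplement S = (\<Inter>y\<in>S. {x. inner y x = 0})"
    using mem_orthocomplement_iff_inner[OF assms] by blast
  then show ?thesis
    by (auto intro!: closed_INT closed_Collect_eq continuous_intros)
qed

lemma bounded_clinear_onD:
  assumes "bounded_clinear_on M N T"
  shows "\<And>x. x \<in> M \<Longrightarrow> T x \<in> N"
    and "\<And>x y. x \<in> M \<Longrightarrow> y \<in> M \<Longrightarrow> T (x + y) = T x + T y"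
    and "\<And>c x. x \<in> M \<Longrightarrow> T (c *\<^sub>C x) = c *\<^sub>C T x"
    and "\<And>r x. x \<in> M \<Longrightarrow> T (r *\<^sub>R x) = r *\<^sub>R T x"
    and "\<exists>K. \<forall>x\<in>M. norm (T x) \<le> K * norm x"
  using assms by (simp_all add: bounded_clinear_on_def scaleR_scaleC)

lemma operator_on_UNIV_imp_bounded_linear:
  assumes "operator_on UNIV T"
  shows "bounded_linear T"
proof -
  obtain K where "\<And>x. norm (T x) \<le> K * norm x"
    using bounded_clinear_onD(5)[OF assms] by blast
  then show ?thesis
    using bounded_clinear_onD(2,4)[OF assms]
    by (intro bounded_linear_intro[of _ K]) (simp_all add: mult.commute)
qed

lemma cinner_adjoint_iff_inner:
  assumes "csubspace M" "operator_on M T"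
  shows "(\<forall>x\<in>M. cinner (T x) y = cinner x z) \<longleftrightarrow> (\<forall>x\<in>M. inner (T x) y = inner x z)"
proof
  assume eq: "\<forall>x\<in>M. inner (T x) y = inner x z"
  show "\<forall>x\<in>M. cinner (T x) y = cinner x z"
  proof
    fix x assume x: "x \<in> M"
    have "T (\<i> *\<^sub>C x) = \<i> *\<^sub>C T x"
      using assms(2) x by (simp add: bounded_clinear_on_def)
    then show "cinner (T x) y = cinner x z"
      using eq x csubspace_scaleC[OF assms(1) x, of \<i>]
      by (intro complex_eqI) (auto simp: Im_cinner inner_eq_Re_cinner[symmetric] dest: bspec)
  qed
qed (auto simp: inner_eq_Re_cinner)

lemma inner_eq_on_imp_eq:
  assumes "csubspace M" "u \<in> M" "v \<in> M" "\<And>x. x \<in> M \<Longrightarrow> inner x u = inner x v"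
  shows "u = v"
proof -
  have "u - v \<in> M"
    using assms(1-3) csubspace_imp_subspace subspace_diff by blast
  then have "inner (u - v) (u - v) = 0"
    using assms(4)[of "u - v"] by (simp add: inner_diff_right)
  then show ?thesis by simp
qed

lemma adjoint_on_eqI:
  assumes "csubspace M" "operator_on M T" "z \<in> M" "\<And>x. x \<in> M \<Longrightarrow> inner (T x) y = inner x z"
  shows "adjoint_on M T y = z"
  unfolding adjoint_on_def
proof (rule the_equality)
  show "z \<in> M \<and> (\<forall>x\<in>M. cinner (T x) y = cinner x z)"
    using assms cinner_adjoint_iff_inner by blast
  fix z' assume "z' \<in> M \<and> (\<forall>x\<in>M. cinner (T x) y = cinner x z')"
  then have "z' \<in> M" "\<And>x. x \<in> M \<Longrightarrow> inner x z' = inner x z"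
    using cinner_adjoint_iff_inner[OF assms(1,2)] assms(4) by force+
  then show "z' = z"
    using inner_eq_on_imp_eq assms(1,3) by blast
qed

text \<open>
  Existence of the adjoint on a closed subspace; together with \<open>adjoint_on_eqI\<close> it justifies the
  definite description in the definition of the adjoint.
\<close>

lemma adjoint_on_inner:
  assumes "csubspace M" "closed M" "operator_on M T"
  shows "adjoint_on M T y \<in> M" and "x \<in> M \<Longrightarrow> inner (T x) y = inner x (adjoint_on M T y)"
proof -
  obtain K where K: "\<And>x. x \<in> M \<Longrightarrow> norm (T x) \<le> K * norm x"
    using bounded_clinear_onD(5)[OF assms(3)] by blast
  have bound: "\<bar>inner (T x) y\<bar> \<le> (K * norm y) * norm x" if "x \<in> M" for x
  proof -
    have "\<bar>inner (T x) y\<bar> \<le> norm (T x) * norm y" by (rule Cauchy_Schwarz_ineq2)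
    also have "\<dots> \<le> (K * norm x) * norm y" by (intro mult_right_mono K that) auto
    finally show ?thesis by (simp add: algebra_simps)
  qed
  have "\<exists>z\<in>M. \<forall>x\<in>M. inner (T x) y = inner x z"
    using csubspace_imp_subspace[OF assms(1)] assms(2) _ _ bound
    by (rule riesz_representation_on)
      (simp_all add: bounded_clinear_onD(2,4)[OF assms(3)] inner_add_left)
  then obtain z where z: "z \<in> M" "\<And>x. x \<in> M \<Longrightarrow> inner (T x) y = inner x z"
    by blast
  then have "adjoint_on M T y = z"
    using assms by (intro adjoint_on_eqI)
  then show "adjoint_on M T y \<in> M" "x \<in> M \<Longrightarrow> inner (T x) y = inner x (adjoint_on M T y)"
    using z by auto
qed

text \<open>
  The form in which posinormality is used: the equation \<open>T\<^sup>*v = Tx\<close> is solvable for every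
  \<open>x\<close>, written as an identity of inner products that does not mention the adjoint.
\<close>

lemma posinormal_on_iff_inner:
  assumes "csubspace M" "closed M" "operator_on M T"
  shows "posinormal_on M T \<longleftrightarrow> (\<forall>x\<in>M. \<exists>v\<in>M. \<forall>w\<in>M. inner (T w) v = inner w (T x))"
proof
  assume "posinormal_on M T"
  then show "\<forall>x\<in>M. \<exists>v\<in>M. \<forall>w\<in>M. inner (T w) v = inner w (T x)"
    using adjoint_on_inner(2)[OF assms] unfolding posinormal_on_def by (metis imageE image_subset_iff)
next
  assume R: "\<forall>x\<in>M. \<exists>v\<in>M. \<forall>w\<in>M. inner (T w) v = inner w (T x)"
  have "T x \<in> adjoint_on M T ` M" if x: "x \<in> M" for x
  proof -
    obtain v where "v \<in> M" "\<forall>w\<in>M. inner (T w) v = inner w (T x)"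
      using R x by blast
    moreover have "T x \<in> M" using assms(3) x by (simp add: bounded_clinear_on_def)
    ultimately show ?thesis
      using adjoint_on_eqI[OF assms(1,3)] by (metis imageI)
  qed
  then show "posinormal_on M T"
    using assms(3) by (auto simp: posinormal_on_def)
qed

text \<open>
  Since \<open>Z\<^sup>*\<^sup>* = Z\<close>, posinormality of \<open>Z\<^sup>*\<close> says that \<open>\<R>(Z\<^sup>*) \<subseteq> \<R>(Z)\<close>: here
  \<open>Z\<^sup>*v = Zw\<close>.
\<close>

lemma coposinormal_on_adjoint_value:
  assumes "csubspace N" "closed N" "coposinormal_on N Z" "v \<in> N"
  shows "\<exists>w\<in>N. \<forall>y\<in>N. inner (Z y) v = inner y (Z w)"
proof -
  define Z' where "Z' = adjoint_on N Z"
  have ops: "operator_on N Z" "operator_on N Z'" "posinormal_on N Z'"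
    using assms(3) by (auto simp: coposinormal_on_def posinormal_on_def Z'_def)
  have Z': "inner (Z x) y = inner x (Z' y)" if "x \<in> N" for x y
    using adjoint_on_inner(2)[OF assms(1,2) ops(1) that] by (simp add: Z'_def)
  obtain w where w: "w \<in> N" "\<forall>y\<in>N. inner (Z' y) w = inner y (Z' v)"
    using ops(3) posinormal_on_iff_inner[OF assms(1,2) ops(2)] assms(4) by blast
  have "inner (Z y) v = inner y (Z w)" if "y \<in> N" for y
  proof -
    have "inner (Z y) v = inner (Z' y) w" using Z' w that by simp
    also have "\<dots> = inner y (Z w)" using Z'[OF w(1), of y] by (simp add: inner_commute)
    finally show ?thesis .
  qed
  then show ?thesis using w(1) by blast
qed

section \<open>Block triangular operators\<close>

lemma orthogonal_decomposition:
  assumes "csubspace N" "closed N"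
  obtains m n where "m \<in> orthocomplement N" "n \<in> N" "x = m + n"
proof -
  obtain n where "n \<in> N" "\<forall>y\<in>N. inner (x - n) y = 0"
    using orthogonal_projection_exists[OF csubspace_imp_subspace[OF assms(1)] assms(2)] by blast
  moreover from this have "x - n \<in> orthocomplement N"
    using mem_orthocomplement_iff_inner[OF assms(1)] by (simp add: inner_commute)
  ultimately show thesis using that[of "x - n" n] by simp
qed

lemma lower_triangular_blockD:
  assumes "has_block_matrix T M N P (\<lambda>_. 0) R S"
  shows "\<And>m. m \<in> M \<Longrightarrow> P m \<in> M"
    and "\<And>m. m \<in> M \<Longrightarrow> R m \<in> N"
    and "\<And>n. n \<in> N \<Longrightarrow> S n \<in> N"
    and "\<And>m n. m \<in> M \<Longrightarrow> n \<in> N \<Longrightarrow> T (m + n) = P m + (R m + S n)"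
  using assms by (simp_all add: has_block_matrix_def bounded_clinear_on_def)

text \<open>
  Comparing \<open>N\<close>-components in \<open>B\<^sup>*g = Bm\<close> gives \<open>Ym = Z\<^sup>*g\<^sub>2\<close>, and coposinormality
  of \<open>Z\<close> turns this into \<open>Ym = Zw\<close>.  So \<open>B(m - w) = B'm\<close>: the corner \<open>Y\<close> is cleared by a
  column operation.
\<close>

lemma closed_range_corner:
  assumes N: "csubspace N" "closed N" and M_def: "M = orthocomplement N"
    and B: "posinormal B" "closed (range B)"
    and block: "has_block_matrix B M N B' (\<lambda>_. 0) Y Z"
    and Z: "coposinormal_on N Z"
  shows "closed (B' ` M)"
proof -
  have M: "csubspace M" "closed M"
    unfolding M_def by (rule csubspace_orthocomplement) (rule closed_orthocomplement[OF N(1)])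
  note decomp = orthogonal_decomposition[OF N, folded M_def]
  note subM = csubspace_imp_subspace[OF M(1)] and subN = csubspace_imp_subspace[OF N(1)]
  have orth: "inner n m = 0" "inner m n = 0" if "m \<in> M" "n \<in> N" for m n
    using that mem_orthocomplement_iff_inner[OF N(1)] M_def by (metis inner_commute)+
  have opB: "operator_on UNIV B" using B(1) by (simp add: posinormal_on_def)
  have maps: "B' m \<in> M" "Y m \<in> N" "Z n \<in> N" if "m \<in> M" "n \<in> N" for m n
    using lower_triangular_blockD(1-3)[OF block] that by blast+
  have B_eq: "B (m + n) = B' m + (Y m + Z n)" if "m \<in> M" "n \<in> N" for m n
    using lower_triangular_blockD(4)[OF block] that by blast
  have 0: "0 \<in> M" "0 \<in> N" using subM subN subspace_0 by auto
  \<comment> \<open>blocks are additive on their own subspaces only, so their value at \<open>0\<close> needs an argument\<close>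
  have B'0: "B' 0 = 0" "Y 0 = 0" "Z 0 = 0"
  proof -
    have "B' (0 + 0) = B' 0 + B' 0" "Y (0 + 0) = Y 0 + Y 0" "Z (0 + 0) = Z 0 + Z 0"
      using block 0 unfolding has_block_matrix_def by (blast intro: bounded_clinear_onD(2))+
    then show "B' 0 = 0" "Y 0 = 0" "Z 0 = 0" by simp_all
  qed
  have Y_range: "\<exists>w\<in>N. Y m = Z w" if m: "m \<in> M" for m
  proof -
    \<comment> \<open>\<open>B\<^sup>*g = Bm\<close>; testing it against \<open>y \<in> N\<close> isolates the bottom row\<close>
    obtain g where g: "\<And>x. inner (B x) g = inner x (B m)"
      using B(1) posinormal_on_iff_inner[OF csubspace_UNIV closed_UNIV opB] by blast
    obtain g1 g2 where g12: "g1 \<in> M" "g2 \<in> N" "g = g1 + g2"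
      by (rule decomp)
    have "inner (Z y) g2 = inner y (Y m)" if y: "y \<in> N" for y
    proof -
      have "B y = Z y" using B_eq[OF 0(1) y] B'0 by simp
      moreover have "B m = B' m + Y m" using B_eq[OF m 0(2)] B'0 by simp
      ultimately show ?thesis
        using g[of y] orth g12 maps m y by (simp add: inner_add_right)
    qed
    moreover obtain w where w: "w \<in> N" "\<forall>y\<in>N. inner (Z y) g2 = inner y (Z w)"
      using coposinormal_on_adjoint_value[OF N Z g12(2)] by blast
    ultimately have "Y m = Z w"
      using inner_eq_on_imp_eq[OF N(1), of "Y m" "Z w"] maps m by auto
    then show ?thesis using w(1) by blast
  qed
  have "B' ` M = range B \<inter> M"
  proof (intro equalityI subsetI)
    fix u assume "u \<in> B' ` M"
    then obtain m where m: "m \<in> M" "u = B' m" by blast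
    obtain w where w: "w \<in> N" "Y m = Z w" using Y_range[OF m(1)] by blast
    have "B w = Z w" using B_eq[OF 0(1) w(1)] B'0 by simp
    moreover have "B m = B' m + Y m" using B_eq[OF m(1) 0(2)] B'0 by simp
    moreover have "B (m - w) = B m - B w"
      using operator_on_UNIV_imp_bounded_linear[OF opB]
      by (simp add: bounded_linear.linear linear_diff)
    ultimately have "u = B (m - w)" using m(2) w(2) by simp
    moreover have "u \<in> M" using m(2) maps[OF m(1) 0(2)] by simp
    ultimately show "u \<in> range B \<inter> M" by simp
  next
    fix u assume u: "u \<in> range B \<inter> M"
    then obtain x where x: "u = B x" by blast
    obtain m n where mn: "m \<in> M" "n \<in> N" "x = m + n"
      by (rule decomp)
    have eq: "u - B' m = Y m + Z n" using B_eq[OF mn(1,2)] x mn(3) by simp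
    have "u - B' m \<in> M" "Y m + Z n \<in> N"
      using u maps[OF mn(1,2)] subspace_diff[OF subM] subspace_add[OF subN] by auto
    then have "inner (u - B' m) (u - B' m) = 0"
      using orth eq by metis
    then show "u \<in> B' ` M" using mn(1) by simp
  qed
  then show ?thesis using B(2) M(2) by auto
qed

theorem corollary4p3:
  fixes A B A' B' Y Z :: "'a::complex_hilbert_space \<Rightarrow> 'a"
  assumes "posinormal A" and "closed (range A)"
    and "posinormal B" and "closed (range B)"
    and "A \<circ> B = B \<circ> A"
    and "has_block_matrix A (orthocomplement (null_space A)) (null_space A)
           A' (\<lambda>_. 0)
           (\<lambda>_. 0) (\<lambda>_. 0)"
    and "has_block_matrix B (orthocomplement (null_space A)) (null_space A)
           B' (\<lambda>_. 0)
           Y Z"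
    and "posinormal_on (orthocomplement (null_space A)) B'"
    and "coposinormal_on (null_space A) Z"
  shows "posinormal (A \<circ> B) \<and> closed (range (A \<circ> B))"
proof -
  define N where "N = null_space A"
  define M where "M = orthocomplement N"
  note blockA = assms(6)[folded N_def, folded M_def]
    and blockB = assms(7)[folded N_def, folded M_def]
    and B'_pos = assms(8)[folded N_def, folded M_def]
    and Z_copos = assms(9)[folded N_def]
  have opA: "operator_on UNIV A" and opB: "operator_on UNIV B" and opB': "operator_on M B'"
    using assms(1,3) B'_pos by (auto simp: posinormal_on_def)
  have blA: "bounded_linear A" and blB: "bounded_linear B"
    using opA opB operator_on_UNIV_imp_bounded_linear by auto
  interpret A: bounded_linear A by fact
  have N: "csubspace N" "closed N"
  proof -
    have "A (c *\<^sub>C x) = c *\<^sub>C A x" for c x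
      using bounded_clinear_onD(3)[OF opA] by simp
    moreover have "c *\<^sub>C (0::'a) = 0" for c
      using scaleC_add_right[of c "0::'a" 0] by simp
    ultimately show "csubspace N"
      by (auto simp: csubspace_def N_def null_space_def A.add A.zero)
    show "closed N"
      unfolding N_def null_space_def
      by (intro closed_Collect_eq A.continuous_on continuous_intros)
  qed
  have M: "csubspace M" "closed M"
    unfolding M_def by (rule csubspace_orthocomplement) (rule closed_orthocomplement[OF N(1)])
  note decomp = orthogonal_decomposition[OF N, folded M_def]
  have M_iff: "x \<in> M \<longleftrightarrow> (\<forall>n. A n = 0 \<longrightarrow> inner n x = 0)" for x
    using mem_orthocomplement_iff_inner[OF N(1)] by (auto simp: M_def N_def null_space_def)
  have orth: "inner n m = 0" if "m \<in> M" "n \<in> N" for m n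
    using that M_iff by (auto simp: N_def null_space_def)
  have maps: "B' m \<in> M" "Y m \<in> N" "Z n \<in> N" if "m \<in> M" "n \<in> N" for m n
    using lower_triangular_blockD(1-3)[OF blockB] that by blast+
  have B_eq: "B (m + n) = B' m + (Y m + Z n)" if "m \<in> M" "n \<in> N" for m n
    using lower_triangular_blockD(4)[OF blockB] that by blast
  have A_N: "A n = 0" if "n \<in> N" for n
    using that by (simp add: N_def null_space_def)
  have A_in_M: "A x \<in> M" for x
  proof -
    obtain m n where "m \<in> M" "n \<in> N" "x = m + n"
      by (rule decomp)
    then show ?thesis
      using lower_triangular_blockD[OF blockA] by simp
  qed
  have AB: "A (B (m + n)) = A (B' m)" if "m \<in> M" "n \<in> N" for m n
    using B_eq[OF that] A_N maps[OF that] by (simp add: A.add)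
  \<comment> \<open>the \<open>N\<close>-part of \<open>B(Ax)\<close> vanishes because \<open>B(Ax) = A(Bx)\<close> lies in \<open>M\<close>\<close>
  have AB_in: "A (B x) \<in> B' ` M" for x
  proof -
    have 0: "0 \<in> N" using N(1) by (simp add: csubspace_def)
    have comm: "A (B x) = B (A x)" using assms(5) by (metis comp_apply)
    have eq: "A (B x) - B' (A x) = Y (A x) + Z 0"
      using B_eq[OF A_in_M 0, of x] comm by simp
    have "A (B x) - B' (A x) \<in> M" "Y (A x) + Z 0 \<in> N"
      using maps[OF A_in_M 0] A_in_M subspace_diff[OF csubspace_imp_subspace[OF M(1)]]
        subspace_add[OF csubspace_imp_subspace[OF N(1)]] by auto
    then have "inner (A (B x) - B' (A x)) (A (B x) - B' (A x)) = 0"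
      using orth eq by metis
    then show ?thesis using A_in_M by auto
  qed
  have opAB: "operator_on UNIV (A \<circ> B)"
  proof -
    obtain K where "\<And>x. norm ((A \<circ> B) x) \<le> norm x * K"
      using bounded_linear.bounded[OF bounded_linear_compose[OF blA blB]] by auto
    then have "\<exists>K. \<forall>x\<in>UNIV. norm ((A \<circ> B) x) \<le> K * norm x"
      by (auto simp: mult.commute)
    then show ?thesis
      using opA opB by (simp add: bounded_clinear_on_def)
  qed
  have "posinormal (A \<circ> B)"
  proof -
    have "\<exists>v. \<forall>x. inner ((A \<circ> B) x) v = inner x ((A \<circ> B) h)" for h
    proof -
      \<comment> \<open>\<open>B'\<^sup>*u = ABh\<close> and \<open>A\<^sup>*v = u\<close>, so that \<open>(AB)\<^sup>*v = ABh\<close>\<close>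
      obtain u where u: "u \<in> M" "\<forall>w\<in>M. inner (B' w) u = inner w (A (B h))"
        using B'_pos posinormal_on_iff_inner[OF M opB'] AB_in[of h] by auto
      obtain v where v: "\<And>x. inner (A x) v = inner x u"
        using closed_range_adjoint_solvable[OF blA assms(2)] M_iff u(1) by blast
      have "inner (A (B x)) v = inner x (A (B h))" for x
      proof -
        obtain m n where mn: "m \<in> M" "n \<in> N" "x = m + n"
          by (rule decomp)
        have "inner (A (B x)) v = inner (B' m) u"
          using AB[OF mn(1,2)] v mn(3) by simp
        also have "\<dots> = inner x (A (B h))"
          using u mn orth[OF A_in_M mn(2)] by (simp add: inner_add_left)
        finally show ?thesis .
      qed
      then show ?thesis by auto
    qed
    then show ?thesis
      using posinormal_on_iff_inner[OF csubspace_UNIV closed_UNIV opAB] by blast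
  qed
  moreover have "closed (range (A \<circ> B))"
  proof -
    have "range (A \<circ> B) = A ` (B' ` M)"
    proof (intro equalityI subsetI)
      fix y assume "y \<in> range (A \<circ> B)"
      then obtain x where "y = A (B x)" by auto
      moreover obtain m n where "m \<in> M" "n \<in> N" "x = m + n"
        by (rule decomp)
      ultimately show "y \<in> A ` (B' ` M)" using AB by auto
    next
      fix y assume "y \<in> A ` (B' ` M)"
      then obtain m where "m \<in> M" "y = A (B' m)" by auto
      then have "y = (A \<circ> B) (m + 0)"
        using AB[of m 0] N(1) by (simp add: csubspace_def)
      then show "y \<in> range (A \<circ> B)" by blast
    qed
    moreover obtain e where e: "e > 0" "\<And>u. u \<in> M \<Longrightarrow> e * norm u \<le> norm (A u)"
      using closed_range_bounded_below[OF blA assms(2)] M_iff by metis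
    moreover have "subspace (B' ` M)"
    proof -
      have "B' x + B' y \<in> B' ` M" "c *\<^sub>R B' x \<in> B' ` M" if "x \<in> M" "y \<in> M" for x y c
      proof -
        have "B' (x + y) = B' x + B' y" "B' (c *\<^sub>R x) = c *\<^sub>R B' x"
          using bounded_clinear_onD(2,4)[OF opB'] that by blast+
        moreover have "x + y \<in> M" "c *\<^sub>R x \<in> M"
          using csubspace_imp_subspace[OF M(1)] that by (auto simp: subspace_add subspace_scale)
        ultimately show "B' x + B' y \<in> B' ` M" "c *\<^sub>R B' x \<in> B' ` M" by (metis imageI)+
      qed
      moreover have "0 \<in> B' ` M"
        using calculation(2)[of 0 0 0] M(1) by (simp add: csubspace_def)
      ultimately show ?thesis by (auto simp: subspace_def)
    qed
    moreover have "closed (B' ` M)"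
      using closed_range_corner[OF N M_def assms(3,4) blockB Z_copos] .
    moreover have "B' ` M \<subseteq> M" using bounded_clinear_onD(1)[OF opB'] by blast
    ultimately show ?thesis
      using complete_isometric_image[of e "B' ` M" A] blA complete_eq_closed
      by (metis subsetD)
  qed
  ultimately show ?thesis by blast
qed

end
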